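(* Let $\nu>3$. Then for every $m=m(n)\in\Omega(n^{\nu})$ (polynomially bounded in $n$), $$-\ln\Big(\Pr_{U\sim\mu_H}\big[\exists S\in\Phi_{m,n}:\ \Pr_{\mathcal{D}_U}[S]\ge \mathrm{e}^{-2n}\big]\Big)\in\Omega\big(n^{\nu-2-1/n}\big),$$ where $\mu_H$ is the Haar measure on $U(m)$ and $\mathcal{D}_U$ is the Boson-Sampling distribution.
   Context: Let $n\ge1$ (number of bosons) and $m\ge n$ (number of modes); throughout $m\in\mathrm{poly}(n)$. The sample space is $\Phi_{m,n}=\{(s_1,\dots,s_m)\in\mathbb{Z}_{\ge0}^m:\sum_{j=1}^m s_j=n\}$. For $U\in U(m)$ and $S=(s_1,\dots,s_m)\in\Phi_{m,n}$, $U_S\in\mathbb{C}^{n\times n}$ is the matrix obtained from $U$ by keeping only the first $n$ columns and then taking, for each $j=1,\dots,m$, $s_j$ copies of the $j$-th row. The permanent of an $n\times n$ matrix $X$ is $\operatorname{Perm}(X)=\sum_{\tau\in\mathrm{Sym}(\{1,\dots,n\})}\prod_{j=1}^n x_{j,\tau(j)}$. The Boson-Sampling distribution $\mathcal{D}_U$ on $\Phi_{m,n}$ is $\Pr_{\mathcal{D}_U}[S]=|\operatorname{Perm}(U_S)|^2/\prod_{j=1}^m s_j!$. Asymptotic notation is for $n\to\infty$: $g(n)\in\Omega(h(n))$ means that there are $C>0$ and $n_0$ with $g(n)\ge C\,h(n)$ for all $n\ge n_0$. Convention: $-\ln 0=+\infty$. *)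

theory Defs
  imports "HOL-Probability.Probability" "Jordan_Normal_Form.Schur_Decomposition"
begin

text \<open>Modes, rows and columns are indexed from 0. Matrices are those of
  \<open>Jordan_Normal_Form\<close>, since the dimension varies with the parameter \<open>n\<close> inside the statement.\<close>

definition sample_space :: "nat \<Rightarrow> nat \<Rightarrow> nat list set" where
  "sample_space m n = {S. length S = m \<and> sum_list S = n}"

definition submatrix_sample :: "nat \<Rightarrow> complex mat \<Rightarrow> nat list \<Rightarrow> complex mat" where
  "submatrix_sample n U S =
     mat_of_rows n
       (concat (map (\<lambda>j. replicate (S ! j) (vec_first (Matrix.row U j) n)) [0..<length S]))"

lemma submatrix_sample_carrier:
  assumes "S \<in> sample_space m n"
  shows "submatrix_sample n U S \<in> carrier_mat n n"
proof -
  have "length (concat (map (\<lambda>j. replicate (S ! j) (f j)) [0..<length S])) = sum_list S"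
    for f :: "nat \<Rightarrow> complex vec"
    by (simp only: length_concat map_map o_def length_replicate map_nth)
  then show ?thesis
    using assms unfolding submatrix_sample_def sample_space_def
    by (intro carrier_matI) (simp_all only: mat_of_rows_carrier mem_Collect_eq)
qed

definition permanent :: "'a mat \<Rightarrow> 'a :: comm_ring_1" where
  "permanent A =
     (if dim_row A = dim_col A
      then \<Sum>p \<in> {p. p permutes {0..<dim_row A}}. \<Prod>i = 0..<dim_row A. A $$ (i, p i)
      else 0)"

definition boson_prob :: "nat \<Rightarrow> complex mat \<Rightarrow> nat list \<Rightarrow> real" where
  "boson_prob n U S =
     (cmod (permanent (submatrix_sample n U S)))\<^sup>2 / (\<Prod>j<length S. fact (S ! j))"

definition unitary_group :: "nat \<Rightarrow> complex mat set" where
  "unitary_group m = {U \<in> carrier_mat m m. mat_adjoint U * U = 1\<^sub>m m}"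

text \<open>The Borel sigma-algebra of \<open>U(m)\<close> as a subspace of the space of complex \<open>m\<close> by \<open>m\<close>
  matrices: a matrix is identified with the family of its entries, and the Borel sigma-algebra of
  a finite (second countable) product is the product of the Borel sigma-algebras. (The type of
  matrices of variable dimension carries no topology of its own.)\<close>

definition unitary_borel :: "nat \<Rightarrow> complex mat measure" where
  "unitary_borel m =
     vimage_algebra (unitary_group m)
       (\<lambda>U. \<lambda>ij \<in> {..<m} \<times> {..<m}. U $$ ij)
       (\<Pi>\<^sub>M ij \<in> {..<m} \<times> {..<m}. (borel :: complex measure))"

text \<open>The Haar measure of the compact group \<open>U(m)\<close>: the unique Borel probability measure that is
  invariant under left translations (it is then invariant under right translations as well).\<close>

definition haar_unitary :: "nat \<Rightarrow> complex mat measure \<Rightarrow> bool" where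
  "haar_unitary m \<mu> \<longleftrightarrow>
     prob_space \<mu> \<and> space \<mu> = unitary_group m \<and> sets \<mu> = sets (unitary_borel m) \<and>
     (\<forall>V \<in> unitary_group m. distr \<mu> \<mu> (\<lambda>U. V * U) = \<mu>)"

lemma unitary_group_mult:
  assumes V: "V \<in> unitary_group m" and U: "U \<in> unitary_group m"
  shows "V * U \<in> unitary_group m"
proof -
  have cV: "V \<in> carrier_mat m m" and cU: "U \<in> carrier_mat m m"
    and aV: "mat_adjoint V \<in> carrier_mat m m" and aU: "mat_adjoint U \<in> carrier_mat m m"
    using V U by (auto simp: unitary_group_def mat_adjoint_def)
  have "mat_adjoint (V * U) = mat_adjoint U * mat_adjoint V"
  proof (rule eq_matI)
    fix i j assume "i < dim_row (mat_adjoint U * mat_adjoint V)"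
      and "j < dim_col (mat_adjoint U * mat_adjoint V)"
    then have ij: "i < m" "j < m" using aU aV by auto
    show "mat_adjoint (V * U) $$ (i, j) = (mat_adjoint U * mat_adjoint V) $$ (i, j)"
      using ij cU cV
      by (auto simp: mat_adjoint_def mat_of_rows_def scalar_prod_def conjugate_dist_mul
            sum_conjugate mult.commute intro!: sum.cong)
  qed (use cU cV in \<open>auto simp: mat_adjoint_def\<close>)
  then have "mat_adjoint (V * U) * (V * U) = mat_adjoint U * (mat_adjoint V * V) * U"
    using cU cV aU aV by (simp add: assoc_mult_mat[of _ m m _ m _ m])
  then show ?thesis
    using V U cU cV aU by (simp add: unitary_group_def)
qed

text \<open>Left translations are measurable, so the image measure above is a genuine one.\<close>

lemma left_mult_measurable:
  assumes V: "V \<in> unitary_group m"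
  shows "(\<lambda>U. V * U) \<in> unitary_borel m \<rightarrow>\<^sub>M unitary_borel m"
proof -
  let ?I = "{..<m} \<times> {..<m}"
  let ?e = "\<lambda>U :: complex mat. \<lambda>ij \<in> ?I. U $$ ij"
  have sp: "space (unitary_borel m) = unitary_group m"
    by (simp add: unitary_borel_def)
  have cV: "V \<in> carrier_mat m m" using V by (simp add: unitary_group_def)
  have e: "?e \<in> unitary_borel m \<rightarrow>\<^sub>M (\<Pi>\<^sub>M ij \<in> ?I. (borel :: complex measure))"
    unfolding unitary_borel_def by (rule measurable_vimage_algebra1) (auto simp: space_PiM)
  have entry: "(\<lambda>U. U $$ ij) \<in> borel_measurable (unitary_borel m)" if "ij \<in> ?I" for ij
    using measurable_compose[OF e measurable_component_singleton[OF that]] that by simp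
  have "(\<lambda>U. (V * U) $$ ij) \<in> borel_measurable (unitary_borel m)" if ij_in: "ij \<in> ?I" for ij
  proof -
    obtain i j where ij: "ij = (i, j)" "i < m" "j < m" using ij_in by auto
    have "(\<lambda>U. \<Sum>k<m. V $$ (i, k) * U $$ (k, j)) \<in> borel_measurable (unitary_borel m)"
      using ij by (intro borel_measurable_sum borel_measurable_times entry) auto
    moreover have "(V * U) $$ ij = (\<Sum>k<m. V $$ (i, k) * U $$ (k, j))"
      if "U \<in> space (unitary_borel m)" for U
      using that ij cV
      by (auto simp: sp unitary_group_def scalar_prod_def lessThan_atLeast0 intro!: sum.cong)
    ultimately show ?thesis by (simp cong: measurable_cong)
  qed
  then have "(\<lambda>U. ?e (V * U)) \<in> unitary_borel m \<rightarrow>\<^sub>M (\<Pi>\<^sub>M ij \<in> ?I. (borel :: complex measure))"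
    by (intro measurable_restrict) auto
  then show ?thesis
    unfolding unitary_borel_def[of m] using V
    by (intro measurable_vimage_algebra2)
      (auto simp: unitary_group_mult)
qed

definition neg_ln :: "real \<Rightarrow> ereal" where
  "neg_ln p = (if p = 0 then \<infinity> else ereal (- ln p))"

text \<open>The library's \<open>\<Omega>\<close> is only available for functions with values in a normed field.\<close>

definition bigomega_ereal :: "(nat \<Rightarrow> real) \<Rightarrow> (nat \<Rightarrow> ereal) set" where
  "bigomega_ereal h = {g. \<exists>C>0. \<exists>n0. \<forall>n\<ge>n0. ereal (C * h n) \<le> g n}"

end

theory Submission
  imports Defs "HOL-Real_Asymp.Real_Asymp"
begin

text \<open>
  Bounding the permanent by \<open>n!\<close> times the \<open>n\<close>-th power of the largest entry modulus, an outcome of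
  probability at least \<open>exp (- 2 n)\<close> forces some entry of \<open>U\<close> to satisfy
  \<open>|U i j|\<^sup>2 \<ge> exp (- 3) / n\<^sup>2\<close>. For the tail of a single entry, replace \<open>U\<close> by \<open>F D U\<close>, where \<open>F\<close> is the
  discrete Fourier matrix and \<open>D\<close> a diagonal matrix of signs; this does not change the Haar
  measure. The \<open>(i, j)\<close> entry becomes a signed sum with coefficients of modulus \<open>|U k j| / sqrt m\<close>,
  whose squares sum to \<open>1 / m\<close>, so averaging over the signs gives Hoeffding's bound
  \<open>exp (l\<^sup>2 / (2 m))\<close> for the moment generating function. Hence the tail of \<open>|U i j|\<^sup>2\<close> at \<open>x\<close> is at
  most \<open>4 exp (- m x / 4)\<close>, and a union bound over the entries with \<open>m / n\<^sup>2\<close> of order at least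
  \<open>n powr (\<nu> - 2)\<close> concludes.
\<close>

section \<open>Exponential moments of random signs\<close>

lemma cosh_le_exp_half_square: "cosh x \<le> exp (x\<^sup>2 / 2)" for x :: real
proof -
  have pos: "cosh x \<le> exp (x\<^sup>2 / 2)" if "x \<ge> 0" for x :: real
  proof -
    \<comment> \<open>This is the log-moment bound for a fair variable with values \<open>0\<close>
      and \<open>2 * x\<close>. The centring term \<open>- x\<close> turns the average of
      \<open>1\<close> and \<open>exp (2 * x)\<close> into \<open>cosh x\<close>. The bound asks for
      a nonnegative length, so negative \<open>x\<close> is left to the evenness of
      \<open>cosh\<close>.\<close>
    have "- (2 * x) * (1/2) + ln (1 + (1/2) * (exp (2 * x) - 1)) \<le> (2 * x)\<^sup>2 / 8"
      using that by (intro Hoeffdings_lemma_aux) auto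
    moreover have "1 + (1/2) * (exp (2 * x) - 1) = exp x * cosh x"
      by (simp add: cosh_field_def field_simps flip: exp_add)
    ultimately have "ln (cosh x) \<le> x\<^sup>2 / 2"
      using cosh_real_pos[of x] by (simp add: ln_mult power2_eq_square)
    then show ?thesis
      using cosh_real_pos[of x] by (metis exp_le_cancel_iff exp_ln)
  qed
  show ?thesis
    using pos[of x] pos[of "- x"] by (cases "x \<ge> 0") auto
qed

text \<open>The subset \<open>X\<close> encodes the sign vector that is \<open>1\<close> on
  \<open>X\<close> and \<open>- 1\<close> elsewhere. Summed over all sign vectors, the exponential
  factorises into the product of the \<open>2 * cosh (b k)\<close>, so each sign can be bounded on
  its own.\<close>

lemma sum_signs_exp_le:
  fixes b :: "'a \<Rightarrow> real"
  assumes "finite A"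
  shows "(\<Sum>X\<in>Pow A. exp (\<Sum>k\<in>A. (if k \<in> X then 1 else - 1) * b k))
    \<le> 2 ^ card A * exp ((\<Sum>k\<in>A. (b k)\<^sup>2) / 2)"
proof -
  have "exp (\<Sum>k\<in>A. (if k \<in> X then 1 else - 1) * b k)
      = (\<Prod>k\<in>X. exp (b k)) * (\<Prod>k\<in>A - X. exp (- b k))" if "X \<in> Pow A" for X
  proof -
    have "(\<Sum>k\<in>A. (if k \<in> X then 1 else - 1) * b k)
        = (\<Sum>k\<in>A - X. - b k) + (\<Sum>k\<in>X. b k)"
      using that assms by (subst sum.subset_diff[of X A]) auto
    then show ?thesis
      using that assms by (auto simp: exp_add exp_sum finite_subset mult.commute)
  qed
  then have "(\<Sum>X\<in>Pow A. exp (\<Sum>k\<in>A. (if k \<in> X then 1 else - 1) * b k))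
      = (\<Prod>k\<in>A. exp (b k) + exp (- b k))"
    using assms by (simp add: prod_add)
  also have "\<dots> = (\<Prod>k\<in>A. 2 * cosh (b k))"
    by (intro prod.cong) (auto simp: cosh_field_def)
  also have "\<dots> \<le> (\<Prod>k\<in>A. 2 * exp ((b k)\<^sup>2 / 2))"
    by (intro prod_mono) (auto simp: cosh_le_exp_half_square)
  also have "\<dots> = 2 ^ card A * exp ((\<Sum>k\<in>A. (b k)\<^sup>2) / 2)"
    using assms by (simp add: prod.distrib exp_sum sum_divide_distrib)
  finally show ?thesis .
qed

section \<open>Unitary matrices and the signed Fourier matrix\<close>

lemma unitary_group_iff:
  "U \<in> unitary_group m \<longleftrightarrow> U \<in> carrier_mat m m \<and>
    (\<forall>i<m. \<forall>j<m. (\<Sum>k<m. cnj (U $$ (k, i)) * U $$ (k, j)) = (if i = j then 1 else 0))"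
proof (cases "U \<in> carrier_mat m m")
  case True
  then have "(mat_adjoint U * U) $$ (i, j) = (\<Sum>k<m. cnj (U $$ (k, i)) * U $$ (k, j))"
    if "i < m" "j < m" for i j
    using that by (auto simp: mat_adjoint_def scalar_prod_def mat_of_rows_def lessThan_atLeast0)
  moreover have "mat_adjoint U \<in> carrier_mat m m"
    using True by (auto simp: mat_adjoint_def)
  ultimately show ?thesis
    using True by (auto simp: unitary_group_def mat_eq_iff)
qed (simp add: unitary_group_def)

lemma unitary_group_column_norm:
  assumes "U \<in> unitary_group m" "j < m"
  shows "(\<Sum>k<m. (cmod (U $$ (k, j)))\<^sup>2) = 1"
proof -
  have "of_real (\<Sum>k<m. (cmod (U $$ (k, j)))\<^sup>2) = (\<Sum>k<m. cnj (U $$ (k, j)) * U $$ (k, j))"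
    by (auto simp: mult.commute complex_norm_square intro!: sum.cong simp del: of_real_power)
  also have "\<dots> = of_real 1"
    using assms by (auto simp: unitary_group_iff)
  finally show ?thesis
    by (simp only: of_real_eq_iff)
qed

text \<open>The product \<open>F D\<close> as one matrix: the normalised discrete Fourier matrix
  with column \<open>k\<close> negated unless \<open>k\<close> lies in \<open>X\<close>. All entries
  have modulus \<open>1 / sqrt m\<close>, so multiplying by it from the left gives the entries of a
  column of \<open>U\<close> equal weights.\<close>

definition signed_fourier :: "nat \<Rightarrow> nat set \<Rightarrow> complex mat" where
  "signed_fourier m X = mat m m
     (\<lambda>(i, k). (if k \<in> X then 1 else - 1) * cis (2 * pi * real i * real k / real m) / sqrt (real m))"

text \<open>Orthogonality of the characters of the integers modulo \<open>m\<close>: the terms are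
  the powers of an \<open>m\<close>-th root of unity \<open>w\<close>, and their geometric sum
  vanishes when \<open>w\<close> is not \<open>1\<close>.\<close>

lemma sum_cis_roots_unity:
  assumes "j < m" "k < m"
  shows "(\<Sum>i<m. cis (2 * pi * real i * (real k - real j) / real m))
    = (if j = k then of_nat m else 0)"
proof (cases "j = k")
  case False
  define w where "w = cis (2 * pi * (real k - real j) / real m)"
  \<comment> \<open>If \<open>w = 1\<close>, then \<open>m\<close> divides \<open>k - j\<close>; as
    both indices lie below \<open>m\<close>, this forces \<open>k = j\<close>.\<close>
  have "w \<noteq> 1"
  proof
    assume "w = 1"
    then have "cos (2 * pi * (real k - real j) / real m) = 1"
      by (simp add: w_def complex_eq_iff)
    then obtain n :: int where "2 * pi * (real k - real j) / real m = n * 2 * pi"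
      by (auto simp: cos_one_2pi_int)
    then have "2 * pi * (real k - real j) = 2 * pi * (n * real m)"
      using assms by (simp add: field_simps)
    then have "real k - real j = n * real m"
      by (subst (asm) mult_cancel_left) simp
    then have n: "int k - int j = n * int m"
      by (metis of_int_diff of_int_eq_iff of_int_mult of_int_of_nat_eq)
    then have "\<bar>n * int m\<bar> < int m"
      using assms by linarith
    then have "\<bar>n\<bar> * int m < 1 * int m"
      by (simp add: abs_mult)
    then have "\<bar>n\<bar> < 1"
      by (rule mult_right_less_imp_less) simp
    then have "n = 0"
      by simp
    then show False
      using n False by simp
  qed
  have "w ^ m = cis (2 * pi * of_int (int k - int j))"
    using assms by (simp add: w_def Complex.DeMoivre)
  then have "w ^ m = 1"
    by (simp only: cis_multiple_2pi Ints_of_int)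
  then have "(\<Sum>i<m. w ^ i) = 0"
    using \<open>w \<noteq> 1\<close> by (simp add: geometric_sum)
  then show ?thesis
    using False by (simp add: w_def Complex.DeMoivre mult_ac)
qed simp

lemma signed_fourier_unitary:
  "signed_fourier m X \<in> unitary_group m"
proof -
  let ?s = "\<lambda>k. (if k \<in> X then 1 else - 1) :: complex"
  have "(\<Sum>i<m. cnj (signed_fourier m X $$ (i, j)) * signed_fourier m X $$ (i, k))
      = (if j = k then 1 else 0)" if jk: "j < m" "k < m" for j k
  proof -
    have "cnj (signed_fourier m X $$ (i, j)) * signed_fourier m X $$ (i, k)
        = ?s j * ?s k / of_nat m * cis (2 * pi * real i * (real k - real j) / real m)"
      if "i < m" for i
    proof -
      have *: "complex_of_real (sqrt (real m)) * complex_of_real (sqrt (real m)) = of_nat m"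
        by (simp flip: of_real_mult)
      have "cis (2 * pi * real i * (real k - real j) / real m)
          = cnj (cis (2 * pi * real i * real j / real m)) * cis (2 * pi * real i * real k / real m)"
        by (simp add: cis_cnj cis_mult diff_divide_distrib right_diff_distrib)
      then show ?thesis
        using that jk by (simp add: signed_fourier_def * times_divide_times_eq)
    qed
    then have "(\<Sum>i<m. cnj (signed_fourier m X $$ (i, j)) * signed_fourier m X $$ (i, k))
        = ?s j * ?s k / of_nat m * (\<Sum>i<m. cis (2 * pi * real i * (real k - real j) / real m))"
      by (simp add: sum_distrib_left)
    \<comment> \<open>The signs survive only for \<open>j = k\<close>, where their product is a
      square and equals \<open>1\<close>.\<close>
    then show ?thesis
      using jk by (simp add: sum_cis_roots_unity)
  qed
  then show ?thesis
    by (auto simp: unitary_group_iff signed_fourier_def)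
qed

lemma signed_fourier_mult_entry:
  assumes "U \<in> carrier_mat m m" "i < m" "j < m"
  shows "(signed_fourier m X * U) $$ (i, j) =
    (\<Sum>k<m. (if k \<in> X then 1 else - 1) *
      (cis (2 * pi * real i * real k / real m) / sqrt (real m) * U $$ (k, j)))"
  using assms
  by (auto simp: signed_fourier_def scalar_prod_def lessThan_atLeast0 intro!: sum.cong)

section \<open>Tail of a single entry under Haar measure\<close>

lemma haar_unitary_entry_measurable:
  assumes "haar_unitary m \<mu>" "i < m" "j < m"
  shows "(\<lambda>U. U $$ (i, j)) \<in> borel_measurable \<mu>"
proof -
  let ?I = "{..<m} \<times> {..<m}"
  have "(\<lambda>U. \<lambda>ij \<in> ?I. U $$ ij) \<in> unitary_borel m \<rightarrow>\<^sub>M (\<Pi>\<^sub>M ij \<in> ?I. (borel :: complex measure))"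
    unfolding unitary_borel_def by (rule measurable_vimage_algebra1) (auto simp: space_PiM)
  from measurable_compose[OF this measurable_component_singleton[of "(i, j)"]]
  have "(\<lambda>U. U $$ (i, j)) \<in> borel_measurable (unitary_borel m)"
    using assms by simp
  then show ?thesis
    using assms by (simp add: haar_unitary_def cong: measurable_cong_sets)
qed

text \<open>Invariance makes the integral the same for all \<open>2 ^ m\<close> sign patterns, while
  for each fixed \<open>U\<close> the average over the patterns obeys Hoeffding's bound. The unit
  scalar \<open>c\<close> picks a direction in the plane, so that one statement covers both tails of
  the real and imaginary parts.\<close>

lemma haar_unitary_mgf_le:
  assumes haar: "haar_unitary m \<mu>" and ij: "i < m" "j < m" and c: "cmod c = 1"
  shows "integrable \<mu> (\<lambda>U. exp (l * Re (c * U $$ (i, j))))"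
    and "(\<integral>U. exp (l * Re (c * U $$ (i, j))) \<partial>\<mu>) \<le> exp (l\<^sup>2 / (2 * real m))"
proof -
  interpret prob_space \<mu>
    using haar by (simp add: haar_unitary_def)
  have sp: "space \<mu> = unitary_group m" and sets: "sets \<mu> = sets (unitary_borel m)"
    using haar by (auto simp: haar_unitary_def)
  note [measurable] = haar_unitary_entry_measurable[OF haar ij]
  let ?f = "\<lambda>U. exp (l * Re (c * U $$ (i, j)))"
  \<comment> \<open>Columns have norm one, so entries have modulus at most one; the integrand is
    bounded, hence integrable on a probability space.\<close>
  have bound: "\<bar>?f U\<bar> \<le> exp \<bar>l\<bar>" if U: "U \<in> unitary_group m" for U
  proof -
    have "(cmod (U $$ (i, j)))\<^sup>2 \<le> 1\<^sup>2"
      using unitary_group_column_norm[OF U ij(2)] ij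
        member_le_sum[of i "{..<m}" "\<lambda>k. (cmod (U $$ (k, j)))\<^sup>2"] by auto
    then have "cmod (U $$ (i, j)) \<le> 1"
      by (rule power2_le_imp_le) simp
    then have "\<bar>Re (c * U $$ (i, j))\<bar> \<le> 1"
      using abs_Re_le_cmod[of "c * U $$ (i, j)"] c by (simp add: norm_mult)
    then have "\<bar>l * Re (c * U $$ (i, j))\<bar> \<le> \<bar>l\<bar>"
      by (simp add: abs_mult mult_left_le)
    then show ?thesis
      by simp
  qed
  show int: "integrable \<mu> ?f"
    by (rule integrable_const_bound[of _ "exp \<bar>l\<bar>"]) (use bound sp in auto)
  have trans: "(\<lambda>U. V * U) \<in> \<mu> \<rightarrow>\<^sub>M \<mu>" if "V \<in> unitary_group m" for V
    using left_mult_measurable[OF that] measurable_cong_sets[OF sets sets] by simp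
  have inv: "distr \<mu> \<mu> (\<lambda>U. V * U) = \<mu>" if "V \<in> unitary_group m" for V
    using haar that by (simp add: haar_unitary_def)
  have eq: "(\<integral>U. ?f (signed_fourier m X * U) \<partial>\<mu>) = (\<integral>U. ?f U \<partial>\<mu>)" for X
    using integral_distr[OF trans[OF signed_fourier_unitary[of m X]], of ?f]
    by (simp add: inv[OF signed_fourier_unitary])
  have int': "integrable \<mu> (\<lambda>U. ?f (signed_fourier m X * U))" for X
    using integrable_distr[OF trans[OF signed_fourier_unitary[of m X]], of ?f] int
    by (simp add: inv[OF signed_fourier_unitary])
  have pointwise: "(\<Sum>X\<in>Pow {..<m}. ?f (signed_fourier m X * U)) \<le> 2 ^ m * exp (l\<^sup>2 / (2 * real m))"
    if U: "U \<in> space \<mu>" for U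
  proof -
    define b where
      "b k = l * Re (c * (cis (2 * pi * real i * real k / real m) / sqrt (real m) * U $$ (k, j)))" for k
    have cU: "U \<in> carrier_mat m m"
      using U by (simp add: sp unitary_group_def)
    have "l * Re (c * (signed_fourier m X * U) $$ (i, j)) = (\<Sum>k<m. (if k \<in> X then 1 else - 1) * b k)" for X
      unfolding signed_fourier_mult_entry[OF cU ij] sum_distrib_left Re_sum b_def
      by (intro sum.cong) (simp_all add: mult_ac del: times_complex.sel)
    then have "(\<Sum>X\<in>Pow {..<m}. ?f (signed_fourier m X * U)) \<le> 2 ^ m * exp ((\<Sum>k<m. (b k)\<^sup>2) / 2)"
      using sum_signs_exp_le[of "{..<m}" b] by simp
    \<comment> \<open>Each Fourier factor contributes \<open>1 / m\<close> to the squared modulus,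
      and the squared moduli in column \<open>j\<close> sum to one.\<close>
    moreover have "(\<Sum>k<m. (b k)\<^sup>2) \<le> l\<^sup>2 / real m"
    proof -
      have "(b k)\<^sup>2 \<le> l\<^sup>2 / real m * (cmod (U $$ (k, j)))\<^sup>2" for k
      proof -
        let ?z = "c * (cis (2 * pi * real i * real k / real m) / sqrt (real m) * U $$ (k, j))"
        have "(Re ?z)\<^sup>2 \<le> (cmod ?z)\<^sup>2"
          by (simp add: cmod_power2)
        also have "\<dots> = (cmod (U $$ (k, j)))\<^sup>2 / real m"
          by (simp add: norm_mult norm_divide c power_mult_distrib power_divide)
        finally have "l\<^sup>2 * (Re ?z)\<^sup>2 \<le> l\<^sup>2 * ((cmod (U $$ (k, j)))\<^sup>2 / real m)"
          by (rule mult_left_mono) simp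
        then show ?thesis
          unfolding b_def power_mult_distrib by (simp only: times_divide_eq_left times_divide_eq_right)
      qed
      then have "(\<Sum>k<m. (b k)\<^sup>2) \<le> (\<Sum>k<m. l\<^sup>2 / real m * (cmod (U $$ (k, j)))\<^sup>2)"
        by (intro sum_mono)
      also have "\<dots> = l\<^sup>2 / real m"
        using unitary_group_column_norm[of U m j] U ij by (simp only: sp mult_1_right flip: sum_distrib_left)
      finally show ?thesis .
    qed
    then have "2 ^ m * exp ((\<Sum>k<m. (b k)\<^sup>2) / 2) \<le> 2 ^ m * exp (l\<^sup>2 / (2 * real m))"
      using divide_right_mono[of _ "l\<^sup>2 / real m" 2] by (simp add: mult.commute)
    ultimately show ?thesis
      by (rule order_trans)
  qed
  have "2 ^ m * (\<integral>U. ?f U \<partial>\<mu>) = (\<Sum>X\<in>Pow {..<m}. \<integral>U. ?f (signed_fourier m X * U) \<partial>\<mu>)"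
    unfolding eq by (simp add: card_Pow)
  also have "\<dots> = (\<integral>U. (\<Sum>X\<in>Pow {..<m}. ?f (signed_fourier m X * U)) \<partial>\<mu>)"
    by (intro Bochner_Integration.integral_sum[symmetric] int')
  also have "\<dots> \<le> (\<integral>U. 2 ^ m * exp (l\<^sup>2 / (2 * real m)) \<partial>\<mu>)"
    by (intro integral_mono pointwise Bochner_Integration.integrable_sum int') auto
  finally show "(\<integral>U. ?f U \<partial>\<mu>) \<le> exp (l\<^sup>2 / (2 * real m))"
    by (simp add: prob_space)
qed

lemma haar_unitary_Re_tail:
  assumes haar: "haar_unitary m \<mu>" and ij: "i < m" "j < m" and c: "cmod c = 1" and "s > 0"
  shows "measure \<mu> {U \<in> space \<mu>. Re (c * U $$ (i, j)) \<ge> s} \<le> exp (- real m * s\<^sup>2 / 2)"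
proof -
  interpret prob_space \<mu>
    using haar by (simp add: haar_unitary_def)
  \<comment> \<open>The minimiser of the Chernoff exponent \<open>- l * s + l^2 / (2 * m)\<close>;
    its minimum is \<open>- m * s^2 / 2\<close>.\<close>
  let ?l = "real m * s"
  have l: "?l > 0"
    using assms by auto
  have "measure \<mu> {U \<in> space \<mu>. Re (c * U $$ (i, j)) \<ge> s}
      \<le> exp (- ?l * s) * (LINT U:space \<mu>|\<mu>. exp (?l * Re (c * U $$ (i, j))))"
    by (intro Chernoff_ineq_ge l)
      (simp_all only: set_integrable_def integrable_mult_indicator sets.top
        haar_unitary_mgf_le(1)[OF haar ij c])
  also have "(LINT U:space \<mu>|\<mu>. exp (?l * Re (c * U $$ (i, j)))) = (\<integral>U. exp (?l * Re (c * U $$ (i, j))) \<partial>\<mu>)"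
    using haar_unitary_mgf_le(1)[OF haar ij c] by (simp add: set_integral_space)
  also have "exp (- ?l * s) * \<dots> \<le> exp (- ?l * s) * exp (?l\<^sup>2 / (2 * real m))"
    by (intro mult_left_mono haar_unitary_mgf_le[OF haar ij c]) auto
  also have "\<dots> = exp (- real m * s\<^sup>2 / 2)"
    using ij by (simp add: field_simps power2_eq_square flip: exp_add)
  finally show ?thesis .
qed

lemma haar_unitary_entry_tail:
  assumes haar: "haar_unitary m \<mu>" and ij: "i < m" "j < m" and "x > 0"
  shows "measure \<mu> {U \<in> space \<mu>. (cmod (U $$ (i, j)))\<^sup>2 \<ge> x} \<le> 4 * exp (- real m * x / 4)"
proof -
  interpret prob_space \<mu>
    using haar by (simp add: haar_unitary_def)
  note [measurable] = haar_unitary_entry_measurable[OF haar ij]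
  \<comment> \<open>If the squared modulus is at least \<open>x\<close>, then the square of the real
    or of the imaginary part is at least \<open>x / 2\<close>. Multiplication by a fourth root of
    unity turns that part, with the right sign, into a real part.\<close>
  let ?C = "{1, - 1, \<i>, - \<i>}"
  let ?s = "sqrt (x / 2)"
  let ?A = "\<lambda>c. {U \<in> space \<mu>. Re (c * U $$ (i, j)) \<ge> ?s}"
  have "{U \<in> space \<mu>. (cmod (U $$ (i, j)))\<^sup>2 \<ge> x} \<subseteq> (\<Union>c\<in>?C. ?A c)"
  proof safe
    fix U assume U: "U \<in> space \<mu>" "x \<le> (cmod (U $$ (i, j)))\<^sup>2"
    let ?z = "U $$ (i, j)"
    have "x / 2 \<le> (Re ?z)\<^sup>2 \<or> x / 2 \<le> (Im ?z)\<^sup>2"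
      using U by (auto simp: cmod_power2)
    then have "?s \<le> \<bar>Re ?z\<bar> \<or> ?s \<le> \<bar>Im ?z\<bar>"
      by (metis real_sqrt_abs real_sqrt_le_iff)
    then have "\<exists>c\<in>?C. ?s \<le> Re (c * ?z)"
      by auto
    then show "U \<in> (\<Union>c\<in>?C. ?A c)"
      using U by auto
  qed
  then have "measure \<mu> {U \<in> space \<mu>. (cmod (U $$ (i, j)))\<^sup>2 \<ge> x} \<le> measure \<mu> (\<Union>c\<in>?C. ?A c)"
    by (intro finite_measure_mono) auto
  also have "\<dots> \<le> (\<Sum>c\<in>?C. measure \<mu> (?A c))"
    by (intro finite_measure_subadditive_finite) auto
  also have "\<dots> \<le> (\<Sum>c\<in>?C. exp (- real m * ?s\<^sup>2 / 2))"
    using assms by (intro sum_mono haar_unitary_Re_tail[OF haar ij]) auto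
  also have "\<dots> \<le> 4 * exp (- real m * x / 4)"
    using \<open>x > 0\<close> by (simp add: complex_eq_iff)
  finally show ?thesis .
qed

section \<open>Permanents and outcome probabilities\<close>

lemma norm_permanent_le:
  fixes A :: "complex mat"
  assumes "A \<in> carrier_mat n n" "\<And>i j. i < n \<Longrightarrow> j < n \<Longrightarrow> cmod (A $$ (i, j)) \<le> y"
  shows "cmod (permanent A) \<le> fact n * y ^ n"
proof -
  have "cmod (permanent A) \<le> (\<Sum>p \<in> {p. p permutes {0..<n}}. cmod (\<Prod>i = 0..<n. A $$ (i, p i)))"
    using assms by (auto simp: permanent_def intro: norm_sum)
  also have "\<dots> \<le> (\<Sum>p \<in> {p. p permutes {0..<n}}. y ^ n)"
  proof (rule sum_mono)
    fix p assume p: "p \<in> {p. p permutes {0..<n}}"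
    have "(\<Prod>i = 0..<n. cmod (A $$ (i, p i))) \<le> (\<Prod>i = 0..<n. y)"
    proof (intro prod_mono conjI assms)
      fix i assume "i \<in> {0..<n}"
      then show "i < n" "p i < n"
        using p permutes_in_image[of p "{0..<n}" i] by auto
    qed auto
    then show "cmod (\<Prod>i = 0..<n. A $$ (i, p i)) \<le> y ^ n"
      by (simp add: prod_norm)
  qed
  also have "\<dots> = fact n * y ^ n"
    by (simp add: card_permutations)
  finally show ?thesis .
qed

text \<open>Repetition of rows is harmless for a bound by the largest entry: it matters only that
  every entry already occurs in \<open>U\<close>.\<close>

lemma submatrix_sample_entry:
  assumes "S \<in> sample_space m n" "U \<in> carrier_mat m m" "n \<le> m" "r < n" "k < n"
  shows "\<exists>i<m. submatrix_sample n U S $$ (r, k) = U $$ (i, k)"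
proof -
  let ?R = "concat (map (\<lambda>j. replicate (S ! j) (vec_first (Matrix.row U j) n)) [0..<length S])"
  have "dim_row (submatrix_sample n U S) = n"
    using submatrix_sample_carrier[OF assms(1)] by auto
  then have r: "r < length ?R"
    using assms by (simp only: submatrix_sample_def mat_of_rows_carrier)
  then have "?R ! r \<in> set ?R"
    by (rule nth_mem)
  then obtain i where i: "i < length S" "?R ! r = vec_first (Matrix.row U i) n"
    by auto
  have "length S = m"
    using assms by (simp add: sample_space_def)
  moreover have "submatrix_sample n U S $$ (r, k) = ?R ! r $ k"
    using r assms by (simp only: submatrix_sample_def mat_of_rows_index)
  ultimately show ?thesis
    using i assms by (auto simp: vec_first_def)
qed

lemma boson_prob_le:
  assumes "S \<in> sample_space m n" "U \<in> carrier_mat m m" "n \<le> m"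
    and x: "\<And>i j. i < m \<Longrightarrow> j < n \<Longrightarrow> (cmod (U $$ (i, j)))\<^sup>2 \<le> x" "x \<ge> 0"
  shows "boson_prob n U S \<le> (real n ^ 2 * x) ^ n"
proof -
  have "cmod (permanent (submatrix_sample n U S)) \<le> fact n * sqrt x ^ n"
  proof (rule norm_permanent_le[OF submatrix_sample_carrier[OF assms(1)]])
    fix r k assume "r < n" "k < n"
    then show "cmod (submatrix_sample n U S $$ (r, k)) \<le> sqrt x"
      using submatrix_sample_entry[OF assms(1-3), of r k] x(1) by (auto intro: real_le_rsqrt)
  qed
  \<comment> \<open>Replacing \<open>n!\<close> by \<open>n ^ n\<close> makes the bound a pure
    \<open>n\<close>-th power, directly comparable with \<open>exp (- 2 * n)\<close>.\<close>
  also have "\<dots> \<le> real n ^ n * sqrt x ^ n"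
    using fact_le_power[of n, where 'a = real] x(2) by (intro mult_right_mono) auto
  finally have "(cmod (permanent (submatrix_sample n U S)))\<^sup>2 \<le> (real n ^ n * sqrt x ^ n)\<^sup>2"
    by (intro power_mono) auto
  also have "\<dots> = (real n ^ 2 * x) ^ n"
    using x(2) by (simp add: power_mult_distrib power2_eq_square mult_ac flip: power_mult_distrib)
  finally have le: "(cmod (permanent (submatrix_sample n U S)))\<^sup>2 \<le> (real n ^ 2 * x) ^ n" .
  have "(\<Prod>j<length S. fact (S ! j)) \<ge> (1 :: real)"
    by (intro prod_ge_1) (auto simp: fact_ge_1)
  then have "boson_prob n U S \<le> (cmod (permanent (submatrix_sample n U S)))\<^sup>2 / 1"
    unfolding boson_prob_def by (intro divide_left_mono) auto
  with le show ?thesis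
    by simp
qed

section \<open>Union bound and asymptotics\<close>

lemma haar_unitary_boson_prob_tail:
  assumes haar: "haar_unitary m \<mu>" and n: "1 \<le> n" "n \<le> m"
  shows "\<P>(U in \<mu>. \<exists>S \<in> sample_space m n. boson_prob n U S \<ge> exp (- 2 * real n))
    \<le> 4 * (real m)\<^sup>2 * exp (- real m * exp (- 3) / (4 * (real n)\<^sup>2))"
proof -
  interpret prob_space \<mu>
    using haar by (simp add: haar_unitary_def)
  \<comment> \<open>Chosen so that \<open>n^2 * x = exp (- 3)\<close>: if no squared modulus exceeds
    \<open>x\<close>, every outcome has probability at most \<open>exp (- 3 * n)\<close>, strictly
    below the threshold since \<open>n \<ge> 1\<close>.\<close>
  define x where "x = exp (- 3) / (real n)\<^sup>2"
  have "x > 0"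
    using n by (simp add: x_def)
  let ?I = "{..<m} \<times> {..<m}"
  let ?A = "\<lambda>(i, j). {U \<in> space \<mu>. (cmod (U $$ (i, j)))\<^sup>2 \<ge> x}"
  have A: "?A ij \<in> sets \<mu>" if "ij \<in> ?I" for ij
  proof -
    obtain i j where ij: "ij = (i, j)" "i < m" "j < m"
      using \<open>ij \<in> ?I\<close> by blast
    note [measurable] = haar_unitary_entry_measurable[OF haar ij(2,3)]
    show ?thesis
      using ij(1) by auto
  qed
  have "{U \<in> space \<mu>. \<exists>S \<in> sample_space m n. boson_prob n U S \<ge> exp (- 2 * real n)}
      \<subseteq> (\<Union>ij\<in>?I. ?A ij)"
  proof (rule subsetI, rule ccontr)
    fix U assume U: "U \<in> {U \<in> space \<mu>. \<exists>S \<in> sample_space m n. boson_prob n U S \<ge> exp (- 2 * real n)}"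
      and "U \<notin> (\<Union>ij\<in>?I. ?A ij)"
    then have small: "(cmod (U $$ (i, j)))\<^sup>2 \<le> x" if "i < m" "j < m" for i j
      using that by force
    obtain S where S: "S \<in> sample_space m n" "boson_prob n U S \<ge> exp (- 2 * real n)"
      using U by auto
    have "U \<in> carrier_mat m m"
      using U haar by (auto simp: haar_unitary_def unitary_group_def)
    then have "boson_prob n U S \<le> (real n ^ 2 * x) ^ n"
      using n \<open>x > 0\<close> S small by (intro boson_prob_le) auto
    also have "\<dots> = exp (- 3 * real n)"
      using n by (simp add: x_def mult.commute flip: exp_of_nat_mult)
    also have "\<dots> < exp (- 2 * real n)"
      using n by simp
    finally show False
      using S by simp
  qed
  \<comment> \<open>Monotonicity of the measure rests on the measurability of the covering union,
    which \<open>A\<close> supplies.\<close>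
  then have "\<P>(U in \<mu>. \<exists>S \<in> sample_space m n. boson_prob n U S \<ge> exp (- 2 * real n))
      \<le> measure \<mu> (\<Union>ij\<in>?I. ?A ij)"
    using A by (intro finite_measure_mono) auto
  also have "\<dots> \<le> (\<Sum>ij\<in>?I. measure \<mu> (?A ij))"
    using A by (intro finite_measure_subadditive_finite) auto
  also have "\<dots> \<le> (\<Sum>ij\<in>?I. 4 * exp (- real m * x / 4))"
    using haar_unitary_entry_tail[OF haar] \<open>x > 0\<close> by (intro sum_mono) auto
  finally show ?thesis
    by (simp add: x_def power2_eq_square mult_ac)
qed

theorem theorem12:
  fixes \<nu> :: real and m :: "nat \<Rightarrow> nat" and \<mu> :: "nat \<Rightarrow> complex mat measure"
  assumes "\<nu> > 3"
    and "\<And>n. n \<ge> 1 \<Longrightarrow> m n \<ge> n"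
    and "\<exists>k::nat. (\<lambda>n. real (m n)) \<in> O(\<lambda>n. real n ^ k)"
    and "(\<lambda>n. real (m n)) \<in> \<Omega>(\<lambda>n. real n powr \<nu>)"
    and "\<And>n. n \<ge> 1 \<Longrightarrow> haar_unitary (m n) (\<mu> n)"
  shows "(\<lambda>n. neg_ln (\<P>(U in \<mu> n.
            \<exists>S \<in> sample_space (m n) n. boson_prob n U S \<ge> exp (- 2 * real n))))
         \<in> bigomega_ereal (\<lambda>n. real n powr (\<nu> - 2 - 1 / real n))"
proof -
  define p where "p n = \<P>(U in \<mu> n.
    \<exists>S \<in> sample_space (m n) n. boson_prob n U S \<ge> exp (- 2 * real n))" for n
  \<comment> \<open>The tail bound has the exponent \<open>- a * t n\<close>, so the whole estimate
    is carried out in terms of \<open>t n\<close>.\<close>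
  define t where "t n = real (m n) / (real n)\<^sup>2" for n
  define a :: real where "a = exp (- 3) / 4"
  have "a > 0"
    by (simp add: a_def)
  obtain c where "c > 0" and c: "eventually (\<lambda>n. norm (real (m n)) \<ge> c * norm (real n powr \<nu>)) at_top"
    using assms(4) by (elim landau_omega.bigE)
  have t_ge: "eventually (\<lambda>n. c * real n powr (\<nu> - 2) \<le> t n) at_top"
    using c eventually_ge_at_top[of 1]
    by eventually_elim (simp add: t_def powr_diff field_simps flip: powr_numeral)
  \<comment> \<open>Here \<open>\<nu> > 3\<close> enters: \<open>t\<close> grows at least linearly,
    so \<open>n\<close> can be replaced by \<open>t n / c\<close> in the prefactor.\<close>
  have t_ge': "eventually (\<lambda>n. c * real n \<le> t n) at_top"
    using t_ge eventually_ge_at_top[of 1]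
  proof eventually_elim
    case (elim n)
    have "real n powr 1 \<le> real n powr (\<nu> - 2)"
      using elim assms(1) by (intro powr_mono) auto
    with elim \<open>c > 0\<close> show ?case
      by (smt (verit) mult_left_mono of_nat_0_le_iff powr_one)
  qed
  have "filterlim (\<lambda>n. c * real n) at_top at_top"
    using \<open>c > 0\<close> by real_asymp
  then have "filterlim t at_top at_top"
    using t_ge' by (rule filterlim_at_top_mono)
  \<comment> \<open>The prefactor \<open>4 * m^2\<close> equals \<open>4 * n^4 * t^2\<close>, hence
    is at most \<open>4 * t^6 / c^4\<close>. Half of the exponent \<open>a * t\<close> is spent on
    absorbing it.\<close>
  moreover have "eventually (\<lambda>x. 4 * x ^ 6 / c ^ 4 \<le> exp (a * x / 2)) at_top"
    using \<open>a > 0\<close> \<open>c > 0\<close> by real_asymp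
  ultimately have poly: "eventually (\<lambda>n. 4 * t n ^ 6 / c ^ 4 \<le> exp (a * t n / 2)) at_top"
    by (rule eventually_compose_filterlim[rotated])
  have "eventually (\<lambda>n. ereal (a * c / 2 * real n powr (\<nu> - 2 - 1 / real n)) \<le> neg_ln (p n)) at_top"
    using t_ge t_ge' poly eventually_ge_at_top[of 1]
  proof eventually_elim
    case (elim n)
    have "p n \<le> 4 * (real (m n))\<^sup>2 * exp (- real (m n) * exp (- 3) / (4 * (real n)\<^sup>2))"
      unfolding p_def using elim assms(2,5) by (intro haar_unitary_boson_prob_tail) auto
    also have "\<dots> = 4 * real n ^ 4 * t n ^ 2 * exp (- a * t n)"
      using elim by (simp add: t_def a_def field_simps)
    also have "\<dots> \<le> 4 * (t n / c) ^ 4 * t n ^ 2 * exp (- a * t n)"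
      using elim \<open>c > 0\<close>
      by (intro mult_right_mono mult_left_mono power_mono) (auto simp: field_simps)
    also have "\<dots> = 4 * t n ^ 6 / c ^ 4 * exp (- a * t n)"
      by (simp add: power_divide flip: power_add)
    also have "\<dots> \<le> exp (a * t n / 2) * exp (- a * t n)"
      using elim by (intro mult_right_mono) auto
    also have "\<dots> = exp (- (a * t n / 2))"
      by (simp flip: exp_add)
    finally have p_le: "p n \<le> exp (- (a * t n / 2))" .
    \<comment> \<open>The estimate holds with the larger exponent \<open>\<nu> - 2\<close>;
      subtracting \<open>1 / n\<close> only lowers the power, as \<open>n \<ge> 1\<close>.\<close>
    have "a * c / 2 * real n powr (\<nu> - 2 - 1 / real n) \<le> a * c / 2 * real n powr (\<nu> - 2)"
      using elim \<open>a > 0\<close> \<open>c > 0\<close> by (intro mult_left_mono powr_mono) auto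
    also have "\<dots> \<le> a * t n / 2"
      using elim \<open>a > 0\<close> by (simp add: mult.assoc)
    finally have le: "a * c / 2 * real n powr (\<nu> - 2 - 1 / real n) \<le> a * t n / 2" .
    show ?case
    proof (cases "p n = 0")
      case False
      then have "p n > 0"
        by (simp add: p_def zero_less_measure_iff)
      then have "ln (p n) \<le> - (a * t n / 2)"
        using p_le by (metis ln_exp ln_le_cancel_iff exp_gt_zero)
      with le False show ?thesis
        by (simp add: neg_ln_def)
    qed (simp add: neg_ln_def)
  qed
  then obtain n0 where
    "\<forall>n\<ge>n0. ereal (a * c / 2 * real n powr (\<nu> - 2 - 1 / real n)) \<le> neg_ln (p n)"
    by (auto simp: eventually_at_top_linorder)
  moreover have "a * c / 2 > 0"
    using \<open>a > 0\<close> \<open>c > 0\<close> by simp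
  ultimately show ?thesis
    unfolding bigomega_ereal_def p_def[symmetric] by blast
qed

end
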